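(* Let $c\ge 0$ and $\alpha>0$ be constants, and let $V:\mathbb{R}\to\mathbb{R}$ be a continuous $T$-periodic function ($T>0$) with $V_m=\min_{t\ge0}|V(t)|>0$ and $V_M=\max_{t\ge 0}|V(t)|$. Let $\mu_\alpha=\sqrt{4\alpha^2-4\alpha+9}$ and $$A_{\alpha}= \frac{(2\alpha +3 -\mu_\alpha)(5-2\alpha +\mu_\alpha)(6\alpha -3 +\mu_\alpha)^2}{4096\,\alpha^3}.$$ If $V_M^2\le A_\alpha$, then the equation $$\ddot{x}+c\,\dot{x}+x-\alpha |x|x = \frac{V^2(t)}{(1-x)^2}$$ admits a periodic solution with the same period $T$ as $V(t)$.
   Context: A solution is a twice differentiable function $x:\mathbb{R}\to(-\infty,1)$ satisfying the equation for all $t$ (the equation is singular at $x=1$). Having period $T$ means $x(t+T)=x(t)$ for all $t$; constant solutions are allowed. *)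

theory Defs
  imports Complex_Main
begin

text \<open>
  For continuous periodic \<open>V\<close> both extrema below are attained, so \<open>LEAST\<close> and
  \<open>GREATEST\<close> really denote the minimum and the maximum of the absolute value on \<open>t \<ge> 0\<close>.
\<close>

definition V_min :: "(real \<Rightarrow> real) \<Rightarrow> real" where
  "V_min V = (LEAST v. v \<in> (\<lambda>t. \<bar>V t\<bar>) ` {0..})"

definition V_max :: "(real \<Rightarrow> real) \<Rightarrow> real" where
  "V_max V = (GREATEST v. v \<in> (\<lambda>t. \<bar>V t\<bar>) ` {0..})"

definition mu :: "real \<Rightarrow> real" where
  "mu \<alpha> = sqrt (4 * \<alpha>^2 - 4 * \<alpha> + 9)"

definition A_bound :: "real \<Rightarrow> real" where
  "A_bound \<alpha> = (2 * \<alpha> + 3 - mu \<alpha>) * (5 - 2 * \<alpha> + mu \<alpha>) * (6 * \<alpha> - 3 + mu \<alpha>)^2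
           / (4096 * \<alpha>^3)"

definition has_period :: "(real \<Rightarrow> real) \<Rightarrow> real \<Rightarrow> bool" where
  "has_period f T \<longleftrightarrow> (\<forall>t. f (t + T) = f t)"

definition is_solution ::
    "real \<Rightarrow> real \<Rightarrow> (real \<Rightarrow> real) \<Rightarrow> (real \<Rightarrow> real) \<Rightarrow> bool" where
  "is_solution c \<alpha> V x \<longleftrightarrow>
     (\<forall>t. x t < 1) \<and>
     (\<exists>x' x''. \<forall>t.
        (x has_real_derivative x' t) (at t) \<and>
        (x' has_real_derivative x'' t) (at t) \<and>
        x'' t + c * x' t + x t - \<alpha> * \<bar>x t\<bar> * x t = (V t)^2 / (1 - x t)^2)"

end

theory Submission
  imports Defs "HOL-Analysis.Analysis"
begin

text \<open>
  Write the equation as \<open>x'' + c x' = f(t, x)\<close>. The constant \<open>A\<^sub>\<alpha>\<close> is the value of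
  \<open>x (1 - \<alpha> x) (1 - x)\<^sup>2\<close> at its critical point \<open>a = (2\<alpha> + 3 - \<mu>\<^sub>\<alpha>) / (8\<alpha>)\<close> in \<open>(0, 1)\<close>, so the
  hypothesis says that \<open>f(t, a) \<le> 0\<close>, while \<open>f(t, b) \<ge> 0\<close> for \<open>b\<close> close to 1 because \<open>V\<close> does not vanish.
  Thus \<open>a \<le> b\<close> are well-ordered lower and upper solutions. As \<open>f\<close> is Lipschitz on \<open>[a, b]\<close>,
  no fixed point theorem is needed: with \<open>K\<close> large, the map sending \<open>u\<close> to the periodic solution
  \<open>x\<close> of \<open>x'' + c x' - K x = f(t, u) - K u\<close> is increasing, and its iterates starting from \<open>a\<close> increase to a
  solution. The linear operator splits as \<open>(D - r\<^sub>1) (D - r\<^sub>2)\<close> with \<open>r\<^sub>1 < 0 < r\<^sub>2\<close>, which reduces its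
  inversion to first order.
\<close>

section \<open>Periodic inversion of first-order linear operators\<close>

text \<open>
  \<open>y = periodic_mean T r h\<close> is the \<open>T\<close>-periodic solution of \<open>y' - r y = - r h\<close>. This normalisation makes
  the operator monotone and makes it fix constants for either sign of \<open>r\<close>.
\<close>

definition periodic_mean :: "real \<Rightarrow> real \<Rightarrow> (real \<Rightarrow> real) \<Rightarrow> real \<Rightarrow> real" where
  "periodic_mean T r h t =
     r / (1 - exp (- r * T)) * exp (r * t) * integral {t..t + T} (\<lambda>s. exp (- r * s) * h s)"

lemma weight_pos:
  fixes r T :: real
  assumes "T > 0" "r \<noteq> 0"
  shows "r / (1 - exp (- r * T)) > 0"
proof (cases "r > 0")
  case True
  with assms show ?thesis by (intro divide_pos_pos) auto
next
  case False
  with assms have "r < 0" by simp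
  with assms show ?thesis by (intro divide_neg_neg) (auto simp: mult_neg_pos)
qed

text \<open>The weight normalises the positive kernel to total mass 1. Combined with monotonicity,
  this makes \<open>periodic_mean\<close> preserve every interval of values
  \<open>{a..b}\<close>.\<close>

lemma periodic_mean_const:
  assumes "T > 0" "r \<noteq> 0"
  shows "periodic_mean T r (\<lambda>_. k) t = k"
proof -
  have "((\<lambda>s. exp (- r * s) * k) has_integral
      (- exp (- r * (t + T)) * k / r - (- exp (- r * t) * k / r))) {t..t + T}"
    using assms
    by (intro fundamental_theorem_of_calculus)
       (auto intro!: derivative_eq_intros simp flip: has_real_derivative_iff_has_vector_derivative)
  then have "integral {t..t + T} (\<lambda>s. exp (- r * s) * k)
      = - exp (- r * (t + T)) * k / r - (- exp (- r * t) * k / r)"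
    by (rule integral_unique)
  also have "\<dots> = exp (- r * t) * ((1 - exp (- r * T)) * k / r)"
  proof -
    have "exp (- r * (t + T)) = exp (- r * t) * exp (- r * T)"
      by (simp add: algebra_simps flip: exp_add)
    then show ?thesis by (simp only:) (simp add: algebra_simps diff_divide_distrib)
  qed
  finally have *: "integral {t..t + T} (\<lambda>s. exp (- r * s) * k)
      = exp (- r * t) * ((1 - exp (- r * T)) * k / r)" .
  have "1 - exp (- r * T) \<noteq> 0" using assms by simp
  then show ?thesis
    using assms unfolding periodic_mean_def *
    by (simp add: exp_minus divide_simps)
qed

lemma periodic_mean_mono:
  assumes "T > 0" "r \<noteq> 0"
    and "continuous_on UNIV g" "continuous_on UNIV h" "\<And>s. g s \<le> h s"
  shows "periodic_mean T r g t \<le> periodic_mean T r h t"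
proof -
  have "continuous_on {t..t+T} g" "continuous_on {t..t+T} h"
    using assms continuous_on_subset by blast+
  then have "integral {t..t + T} (\<lambda>s. exp (- r * s) * g s) \<le> integral {t..t + T} (\<lambda>s. exp (- r * s) * h s)"
    using assms by (intro integral_le integrable_continuous_interval continuous_intros) auto
  moreover have "r / (1 - exp (- r * T)) * exp (r * t) \<ge> 0"
    using weight_pos[OF assms(1,2)] by (intro mult_nonneg_nonneg) auto
  ultimately show ?thesis
    unfolding periodic_mean_def by (intro mult_left_mono)
qed

text \<open>Integrability of the integrand suffices because an indefinite integral is continuous.
  This form is meant for a pointwise limit whose continuity is not yet known.\<close>

lemma continuous_on_periodic_mean:
  assumes "T > 0"
    and "\<And>p q. (\<lambda>s. exp (- r * s) * h s) integrable_on {p..q}"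
  shows "continuous_on UNIV (periodic_mean T r h)"
proof -
  let ?k = "\<lambda>s. exp (- r * s) * h s"
  have "isCont (periodic_mean T r h) t" for t
  proof -
    let ?p = "t - 1" and ?q = "t + T + 1"
    have cont: "continuous_on {?p..?q} (\<lambda>x. integral {?p..x} ?k)"
      by (intro indefinite_integral_continuous_1 assms(2))
    \<comment> \<open>A fixed base point left of the sliding window turns its integral into a
      difference of two indefinite integrals.\<close>
    have eq: "periodic_mean T r h x = r / (1 - exp (- r * T)) * exp (r * x) *
        (integral {?p..x + T} ?k - integral {?p..x} ?k)" if "x \<in> {?p<..<t + 1}" for x
      using Henstock_Kurzweil_Integration.integral_combine[of ?p x "x + T" ?k] that assms
      by (simp add: periodic_mean_def)
    have "continuous_on {?p<..<t+1} (\<lambda>x. r / (1 - exp (- r * T)) * exp (r * x) *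
        (integral {?p..x + T} ?k - integral {?p..x} ?k))"
      by (intro continuous_intros continuous_on_subset[OF cont]
          continuous_on_compose2[OF cont, of _ "\<lambda>x. x + T"]) (use \<open>T > 0\<close> in auto)
    then have "continuous_on {?p<..<t+1} (periodic_mean T r h)"
      by (subst continuous_on_cong[OF refl eq]) auto
    then show ?thesis
      by (rule continuous_on_interior) (auto simp: interior_open)
  qed
  then show ?thesis by (simp add: continuous_on_eq_continuous_at)
qed

lemma continuous_on_periodic_mean':
  assumes "T > 0" "continuous_on UNIV h"
  shows "continuous_on UNIV (periodic_mean T r h)"
  using assms
  by (intro continuous_on_periodic_mean integrable_continuous_interval continuous_intros)
     (auto intro: continuous_on_subset)

text \<open>Substituting \<open>s + T\<close> for \<open>s\<close> leaves \<open>h\<close> unchanged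
  and pulls out the factor \<open>exp (- r * T)\<close>, which cancels the growth of
  \<open>exp (r * t)\<close> over one period.\<close>

lemma integral_window_shift:
  assumes "T > 0" "continuous_on UNIV h" "has_period h T"
  shows "integral {t + T..t + T + T} (\<lambda>s. exp (- r * s) * h s)
      = exp (- r * T) * integral {t..t + T} (\<lambda>s. exp (- r * s) * h s)"
proof -
  let ?k = "\<lambda>s. exp (- r * s) * h s"
  have "integral {t + T..t + T + T} ?k = integral {t..t + T} (?k \<circ> (\<lambda>s. s + T))"
    using integral_shift_real_ivl[of "t + T" T "t + T + T" ?k] by (simp add: o_def add_ac)
  also have "?k \<circ> (\<lambda>s. s + T) = (\<lambda>s. exp (- r * T) * ?k s)"
    using assms(3) by (auto simp: has_period_def algebra_simps exp_add fun_eq_iff exp_diff exp_minus divide_simps)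
  finally show ?thesis by simp
qed

lemma has_period_periodic_mean:
  assumes "T > 0" "continuous_on UNIV h" "has_period h T"
  shows "has_period (periodic_mean T r h) T"
  unfolding has_period_def periodic_mean_def integral_window_shift[OF assms]
  by (simp add: algebra_simps exp_add exp_minus)

lemma periodic_mean_has_real_derivative:
  assumes "T > 0" "r \<noteq> 0" "continuous_on UNIV h" "has_period h T"
  shows "(periodic_mean T r h has_real_derivative r * (periodic_mean T r h t - h t)) (at t)"
proof -
  let ?k = "\<lambda>s. exp (- r * s) * h s"
  let ?w = "r / (1 - exp (- r * T))"
  let ?p = "t - 1" and ?q = "t + T + 1"
  have contk: "continuous_on S ?k" for S
    using assms(3) by (intro continuous_intros) (auto intro: continuous_on_subset)
  have der: "((\<lambda>x. integral {?p..x} ?k) has_real_derivative ?k x) (at x)" if "x \<in> {?p<..<?q}" for x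
  proof -
    have "((\<lambda>x. integral {?p..x} ?k) has_real_derivative ?k x) (at x within {?p..?q})"
      by (rule integral_has_real_derivative) (use that contk in auto)
    moreover have "at x within {?p..?q} = at x"
      using that by (intro at_within_interior) auto
    ultimately show ?thesis by simp
  qed
  have eq: "periodic_mean T r h x = ?w * exp (r * x) *
      (integral {?p..x + T} ?k - integral {?p..x} ?k)" if "x \<in> {?p<..<t + 1}" for x
    using Henstock_Kurzweil_Integration.integral_combine[of ?p x "x + T" ?k] that assms(1)
      integrable_continuous_interval[OF contk]
    by (simp add: periodic_mean_def)
  have d1: "((\<lambda>x. integral {?p..x} ?k) has_real_derivative ?k t) (at t)"
    using assms by (intro der) auto
  have d2: "((\<lambda>x. integral {?p..x + T} ?k) has_real_derivative ?k (t + T)) (at t)"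
    by (rule DERIV_shift[THEN iffD1], rule der) (use assms in auto)
  have "((\<lambda>x. ?w * exp (r * x) * (integral {?p..x + T} ?k - integral {?p..x} ?k)) has_real_derivative
      ?w * (exp (r * t) * r) * (integral {?p..t + T} ?k - integral {?p..t} ?k)
      + ?w * exp (r * t) * (?k (t + T) - ?k t)) (at t)"
    by (rule derivative_eq_intros d1 d2 refl)+ (simp add: mult_ac)
  then have "(periodic_mean T r h has_real_derivative
      ?w * (exp (r * t) * r) * (integral {?p..t + T} ?k - integral {?p..t} ?k)
      + ?w * exp (r * t) * (?k (t + T) - ?k t)) (at t)"
    by (rule has_field_derivative_transform_within_open[where S = "{?p<..<t+1}"]) (use eq in auto)
  moreover have "?w * (exp (r * t) * r) * (integral {?p..t + T} ?k - integral {?p..t} ?k)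
      = r * periodic_mean T r h t"
    by (subst eq) auto
  \<comment> \<open>Periodicity of \<open>h\<close> merges the two boundary terms; their common
    factor \<open>1 - exp (- r * T)\<close> is the denominator of the weight.\<close>
  moreover have "?w * exp (r * t) * (?k (t + T) - ?k t) = - r * h t"
  proof -
    have "h (t + T) = h t" using assms(4) by (simp add: has_period_def)
    moreover have "exp (r * t) * exp (- r * (t + T)) = exp (- r * T)"
      "exp (r * t) * exp (- r * t) = 1"
      by (simp_all add: algebra_simps flip: exp_add)
    ultimately have "exp (r * t) * (?k (t + T) - ?k t) = - (1 - exp (- r * T)) * h t"
      by (simp only: right_diff_distrib mult.assoc[symmetric]) (simp add: algebra_simps)
    moreover have "1 - exp (- r * T) \<noteq> 0" using assms by simp
    ultimately show ?thesis
      by (simp only: mult.assoc) (simp add: field_simps)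
  qed
  ultimately have "(periodic_mean T r h has_real_derivative r * periodic_mean T r h t + - r * h t) (at t)"
    by (simp only:)
  then show ?thesis by (simp add: right_diff_distrib)
qed

text \<open>Dominated convergence, with dominating function \<open>exp (- r * s) * B\<close>. The
  integrability conclusion supplies the hypothesis of \<open>continuous_on_periodic_mean\<close> for
  the limit \<open>g\<close>.\<close>

lemma periodic_mean_limit:
  assumes "\<And>n. continuous_on UNIV (h n)" "\<And>n s. \<bar>h n s\<bar> \<le> B"
    and lim: "\<And>s. (\<lambda>n. h n s) \<longlonglongrightarrow> g s"
  shows "(\<lambda>s. exp (- r * s) * g s) integrable_on {p..q}"
    and "(\<lambda>n. periodic_mean T r (h n) t) \<longlonglongrightarrow> periodic_mean T r g t"
proof -
  have hint: "(\<lambda>s. exp (- r * s) * h n s) integrable_on {p..q}" for n p q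
    using assms(1) by (intro integrable_continuous_interval continuous_intros) (auto intro: continuous_on_subset)
  have Bint: "(\<lambda>s. exp (- r * s) * B) integrable_on {p..q}" for p q
    by (intro integrable_continuous_interval continuous_intros)
  have bd: "norm (exp (- r * s) * h n s) \<le> exp (- r * s) * B" for n s
    using assms(2) by (simp add: abs_mult)
  have li: "(\<lambda>n. exp (- r * s) * h n s) \<longlonglongrightarrow> exp (- r * s) * g s" for s
    by (intro tendsto_intros lim)
  show "(\<lambda>s. exp (- r * s) * g s) integrable_on {p..q}"
    by (rule dominated_convergence(1)[OF hint Bint bd li])
  have "(\<lambda>n. integral {t..t + T} (\<lambda>s. exp (- r * s) * h n s)) \<longlonglongrightarrow> integral {t..t + T} (\<lambda>s. exp (- r * s) * g s)"
    by (rule dominated_convergence(2)[OF hint Bint bd li])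
  then show "(\<lambda>n. periodic_mean T r (h n) t) \<longlonglongrightarrow> periodic_mean T r g t"
    unfolding periodic_mean_def by (intro tendsto_intros)
qed

section \<open>Monotone iteration for the second-order equation\<close>

text \<open>These are the roots of \<open>z^2 + c * z - K\<close>; their product is negative, so
  they are real with opposite signs.\<close>

lemma characteristic_roots:
  fixes c K :: real
  assumes "K > 0"
  obtains r1 r2 where "r1 < 0" "r2 > 0" "r1 + r2 = - c" "r1 * r2 = - K"
proof
  let ?d = "sqrt (c\<^sup>2 + 4 * K)"
  have "\<bar>c\<bar> < ?d"
    using assms by (intro real_less_rsqrt) auto
  then show "(- c - ?d) / 2 < 0" "(- c + ?d) / 2 > 0" by auto
  show "(- c - ?d) / 2 + (- c + ?d) / 2 = - c" by (simp add: field_simps)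
  have "?d * ?d = c\<^sup>2 + 4 * K" using assms by simp
  then show "(- c - ?d) / 2 * ((- c + ?d) / 2) = - K"
    by (simp add: algebra_simps power2_eq_square)
qed

text \<open>The constants \<open>a\<close> and \<open>b\<close> are a lower and an upper solution.
  The one-sided bound \<open>growth\<close> is exactly what makes \<open>x - f t x / K\<close>
  increasing in \<open>x\<close>, hence the iteration monotone.\<close>

lemma periodic_solution_between_constants:
  fixes f :: "real \<Rightarrow> real \<Rightarrow> real"
  assumes "T > 0" "a \<le> b" "K > 0"
    and cont: "continuous_on (UNIV \<times> {a..b}) (\<lambda>(t, x). f t x)"
    and per: "\<And>t x. f (t + T) x = f t x"
    and growth: "\<And>t x y. a \<le> x \<Longrightarrow> x \<le> y \<Longrightarrow> y \<le> b \<Longrightarrow> f t y - f t x \<le> K * (y - x)"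
    and lower: "\<And>t. f t a \<le> 0" and upper: "\<And>t. f t b \<ge> 0"
  obtains u u' u'' where "has_period u T" "\<And>t. u t \<in> {a..b}"
    "\<And>t. (u has_real_derivative u' t) (at t)"
    "\<And>t. (u' has_real_derivative u'' t) (at t)"
    "\<And>t. u'' t + c * u' t = f t (u t)"
proof -
  obtain r1 r2 where r: "r1 < 0" "r2 > 0" "r1 + r2 = - c" "r1 * r2 = - K"
    using characteristic_roots[OF \<open>K > 0\<close>] .
  then have r0: "r1 \<noteq> 0" "r2 \<noteq> 0" by auto
  define adm where "adm u \<longleftrightarrow> continuous_on UNIV u \<and> has_period u T \<and> (\<forall>t. u t \<in> {a..b})"
    for u :: "real \<Rightarrow> real"
  \<comment> \<open>Since \<open>r1 * r2 = - K\<close>, the linear equation with right-hand side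
    \<open>f t (u t) - K * u t\<close> reads \<open>(D - r1) (D - r2) x = r1 * r2 * G u\<close>. Its
    periodic solution is \<open>N u\<close>, one mean per factor.\<close>
  define G where "G u t = u t - f t (u t) / K" for u :: "real \<Rightarrow> real" and t
  define N where "N u = periodic_mean T r1 (periodic_mean T r2 (G u))" for u
  have G_mono: "x - f t x / K \<le> y - f t y / K" if "a \<le> x" "x \<le> y" "y \<le> b" for t x y
  proof -
    have "(f t y - f t x) / K \<le> y - x"
      using growth[OF that, of t] \<open>K > 0\<close> by (simp add: pos_divide_le_eq mult.commute)
    then show ?thesis by (simp add: diff_divide_distrib)
  qed
  \<comment> \<open>The signs of \<open>f\<close> at \<open>a\<close> and \<open>b\<close> enter
    here: the increasing map \<open>x - f t x / K\<close> sends \<open>a\<close> above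
    \<open>a\<close> and \<open>b\<close> below \<open>b\<close>.\<close>
  have G_range: "G u t \<in> {a..b}" if "u t \<in> {a..b}" for u t
  proof -
    have "a \<le> a - f t a / K" "b - f t b / K \<le> b"
      using lower[of t] upper[of t] \<open>K > 0\<close> by (auto simp: field_simps)
    then show ?thesis
      using G_mono[of a "u t" t] G_mono[of "u t" b t] that by (auto simp: G_def)
  qed
  have G_adm: "adm (G u)" if "adm u" for u
  proof -
    have u: "continuous_on UNIV u" "has_period u T" "\<And>t. u t \<in> {a..b}"
      using that by (auto simp: adm_def)
    have "continuous_on UNIV (\<lambda>t. case (t, u t) of (t, x) \<Rightarrow> f t x)"
      by (rule continuous_on_compose2[OF cont]) (use u in \<open>auto intro!: continuous_intros\<close>)
    then have "continuous_on UNIV (G u)"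
      unfolding G_def using u \<open>K > 0\<close> by (intro continuous_intros) auto
    moreover have "has_period (G u) T"
      using u(2) per by (simp add: has_period_def G_def)
    ultimately show ?thesis using G_range u(3) by (simp add: adm_def)
  qed
  have P_range: "periodic_mean T s u t \<in> {a..b}"
    if "s \<noteq> 0" "continuous_on UNIV u" "\<And>t. u t \<in> {a..b}" for s u t
    using that periodic_mean_mono[OF \<open>T > 0\<close>, of s "\<lambda>_. a" u t]
      periodic_mean_mono[OF \<open>T > 0\<close>, of s u "\<lambda>_. b" t]
    by (auto simp: periodic_mean_const \<open>T > 0\<close>)
  have P_adm: "adm (periodic_mean T s u)" if "s \<noteq> 0" "adm u" for s u
    using that P_range[of s u] continuous_on_periodic_mean'[of T u s] has_period_periodic_mean[of T u s] \<open>T > 0\<close>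
    by (auto simp: adm_def)
  have N_adm: "adm (N u)" if "adm u" for u
    unfolding N_def by (intro P_adm G_adm r0 that)
  have N_mono: "N u t \<le> N v t" if "adm u" "adm v" "\<And>t. u t \<le> v t" for u v t
    unfolding N_def
  proof (intro periodic_mean_mono \<open>T > 0\<close> r0)
    show "G u s \<le> G v s" for s
      unfolding G_def by (intro G_mono) (use that in \<open>auto simp: adm_def\<close>)
  qed (use P_adm[OF r0(2)] G_adm that in \<open>auto simp: adm_def\<close>)
  define X where "X n = (N ^^ n) (\<lambda>_. a)" for n
  have X_Suc: "X (Suc n) = N (X n)" for n by (simp add: X_def)
  have X_adm: "adm (X n)" for n
  proof (induction n)
    case 0
    then show ?case using \<open>a \<le> b\<close> by (simp add: X_def adm_def has_period_def)
  qed (simp add: X_Suc N_adm)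
  have X_range: "a \<le> X n t" "X n t \<le> b" for n t using X_adm[of n] by (auto simp: adm_def)
  \<comment> \<open>The iteration starts at the least admissible function, so the first step goes
    up; monotonicity of \<open>N\<close> propagates this.\<close>
  have X_inc: "X n t \<le> X (Suc n) t" for n t
  proof (induction n arbitrary: t)
    case 0
    then show ?case using X_range(1)[of "Suc 0" t] by (simp add: X_def)
  next
    case (Suc n)
    then show ?case by (subst (1 2) X_Suc) (intro N_mono X_adm)
  qed
  have "\<exists>l. (\<lambda>n. X n t) \<longlonglongrightarrow> l" for t
    using incseq_convergent[of "\<lambda>n. X n t" b] X_inc X_range(2) by (metis incseq_SucI)
  then obtain u where lim_X: "\<And>t. (\<lambda>n. X n t) \<longlonglongrightarrow> u t" by metis
  have u_range: "u t \<in> {a..b}" for t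
    using LIMSEQ_le_const[OF lim_X] LIMSEQ_le_const2[OF lim_X] X_range by auto
  have u_per: "has_period u T"
    unfolding has_period_def
  proof
    fix t
    have "(\<lambda>n. X n (t + T)) = (\<lambda>n. X n t)"
      using X_adm by (simp add: adm_def has_period_def)
    then show "u (t + T) = u t"
      using lim_X[of "t + T"] lim_X[of t] LIMSEQ_unique by metis
  qed
  \<comment> \<open>The intermediate function of the factorisation; once
    \<open>u = periodic_mean T r1 y\<close> is known, \<open>y\<close> equals
    \<open>u - u' / r1\<close>, so it carries the first derivative.\<close>
  define y where "y = periodic_mean T r2 (G u)"
  have bound: "\<bar>v t\<bar> \<le> max \<bar>a\<bar> \<bar>b\<bar>" if "adm v" for v t
  proof -
    have "v t \<in> {a..b}" using that by (simp add: adm_def)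
    then show ?thesis by auto
  qed
  have lim_G: "(\<lambda>n. G (X n) t) \<longlonglongrightarrow> G u t" for t
  proof -
    have "continuous_on {a..b} (\<lambda>x. case (t, x) of (t, x) \<Rightarrow> f t x)"
      by (rule continuous_on_compose2[OF cont]) (auto intro!: continuous_intros)
    then have "continuous_on {a..b} (f t)" by simp
    then have "(\<lambda>n. f t (X n t)) \<longlonglongrightarrow> f t (u t)"
      by (rule continuous_on_tendsto_compose[OF _ lim_X]) (use u_range X_range in auto)
    then show ?thesis
      unfolding G_def using \<open>K > 0\<close> by (intro tendsto_intros lim_X) auto
  qed
  note GX = G_adm[OF X_adm]
  have GX_cont: "continuous_on UNIV (G (X n))" for n using GX by (simp add: adm_def)
  have PX: "adm (periodic_mean T r2 (G (X n)))" for n by (rule P_adm[OF r0(2) GX])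
  then have PX_cont: "continuous_on UNIV (periodic_mean T r2 (G (X n)))" for n by (simp add: adm_def)
  note lim_G_mean = periodic_mean_limit[OF GX_cont bound[OF GX] lim_G]
  have y_cont: "continuous_on UNIV y"
    unfolding y_def by (rule continuous_on_periodic_mean[OF \<open>T > 0\<close> lim_G_mean(1)])
  have "(\<lambda>n. X (Suc n) t) \<longlonglongrightarrow> periodic_mean T r1 y t" for t
    unfolding X_Suc N_def y_def
    by (rule periodic_mean_limit(2)[OF PX_cont bound[OF PX] lim_G_mean(2)])
  then have u_eq: "u = periodic_mean T r1 y"
    using LIMSEQ_unique LIMSEQ_Suc[OF lim_X] by blast
  \<comment> \<open>a pointwise limit is a priori only measurable; the two integrations restore continuity\<close>
  have "continuous_on UNIV u"
    unfolding u_eq by (rule continuous_on_periodic_mean'[OF \<open>T > 0\<close> y_cont])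
  then have u_adm: "adm u" using u_per u_range by (simp add: adm_def)
  have y_adm: "adm y" unfolding y_def by (intro P_adm G_adm r0 u_adm)
  \<comment> \<open>The first-order equation for \<open>u\<close> gives \<open>u'\<close> explicitly
    in terms of \<open>u\<close> and \<open>y\<close>. Both are differentiable, so a second
    derivative exists.\<close>
  define u' where "u' t = r1 * (u t - y t)" for t
  have du: "(u has_real_derivative u' t) (at t)" for t
    using periodic_mean_has_real_derivative[OF \<open>T > 0\<close> r0(1), of y t] y_adm
    unfolding u_eq[symmetric] u'_def by (simp add: adm_def)
  have dy: "(y has_real_derivative r2 * (y t - G u t)) (at t)" for t
    using periodic_mean_has_real_derivative[OF \<open>T > 0\<close> r0(2), of "G u" t] G_adm[OF u_adm]
    unfolding y_def by (simp add: adm_def)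
  show thesis
  proof (rule that[OF u_per u_range du])
    show "(u' has_real_derivative r1 * (u' t - r2 * (y t - G u t))) (at t)" for t
      unfolding u'_def[abs_def] by (rule derivative_eq_intros du dy refl)+ (simp add: u'_def)
    show "r1 * (u' t - r2 * (y t - G u t)) + c * u' t = f t (u t)" for t
    proof -
      have "r1 * (u' t - r2 * (y t - G u t)) + c * u' t
          = r1 * (r1 + c) * (u t - y t) - r1 * r2 * (y t - G u t)"
        by (simp add: u'_def algebra_simps)
      also have "r1 + c = - r2" using r(3) by simp
      also have "r1 * - r2 * (u t - y t) - r1 * r2 * (y t - G u t) = - (r1 * r2) * (u t - G u t)"
        by (simp add: algebra_simps)
      also have "\<dots> = f t (u t)"
        using \<open>K > 0\<close> unfolding r(4) by (simp add: G_def)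
      finally show ?thesis .
    qed
  qed
qed

section \<open>Bounds on the periodic coefficient\<close>

lemma periodic_eq_in_window:
  assumes "T > 0" "has_period V T"
  obtains s where "s \<in> {0..T}" "V s = V t"
proof -
  have shift_nat: "V (s + real n * T) = V s" for s n
  proof (induction n)
    case (Suc n)
    have "V (s + real (Suc n) * T) = V ((s + real n * T) + T)" by (simp add: algebra_simps)
    then show ?case using Suc assms(2) by (simp add: has_period_def)
  qed simp
  have shift_int: "V (s + of_int k * T) = V s" for s k
  proof (cases "k \<ge> 0")
    case True
    then show ?thesis using shift_nat[of s "nat k"] by simp
  next
    case False
    then show ?thesis using shift_nat[of "s + of_int k * T" "nat (- k)"] by simp
  qed
  let ?k = "\<lfloor>t / T\<rfloor>"
  have "of_int ?k * T \<le> t" "t < (of_int ?k + 1) * T"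
    using assms floor_divide_lower[of T t] floor_divide_upper[of T t] by auto
  then show thesis
    using shift_int[of t "- ?k"] by (intro that[of "t + of_int (- ?k) * T"]) (auto simp: algebra_simps)
qed

text \<open>The extrema over the compact interval \<open>{0..T}\<close> are attained, and by
  periodicity every value of \<open>V\<close> occurs there. Hence they are also the extrema over
  \<open>t \<ge> 0\<close> and bound \<open>V\<close> on the whole line.\<close>

lemma V_min_le_abs_le_V_max:
  assumes "T > 0" "continuous_on UNIV V" "has_period V T"
  shows "V_min V \<le> \<bar>V t\<bar>" "\<bar>V t\<bar> \<le> V_max V"
proof -
  have c: "continuous_on {0..T} (\<lambda>t. \<bar>V t\<bar>)"
    using assms by (intro continuous_intros) (auto intro: continuous_on_subset)
  have window: "\<exists>s\<in>{0..T}. \<bar>V s\<bar> = \<bar>V t\<bar>" for t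
    using periodic_eq_in_window[OF assms(1,3)] by metis
  obtain m where m: "m \<in> {0..T}" "\<And>s. s \<in> {0..T} \<Longrightarrow> \<bar>V m\<bar> \<le> \<bar>V s\<bar>"
    using continuous_attains_inf[OF _ _ c] assms by auto
  obtain M where M: "M \<in> {0..T}" "\<And>s. s \<in> {0..T} \<Longrightarrow> \<bar>V s\<bar> \<le> \<bar>V M\<bar>"
    using continuous_attains_sup[OF _ _ c] assms by auto
  have m': "\<bar>V m\<bar> \<le> \<bar>V s\<bar>" and M': "\<bar>V s\<bar> \<le> \<bar>V M\<bar>" for s
    using window[of s] m M by metis+
  have "V_min V = \<bar>V m\<bar>"
    unfolding V_min_def by (rule Least_equality) (use m m' in auto)
  with m' show "V_min V \<le> \<bar>V t\<bar>" by simp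
  have "V_max V = \<bar>V M\<bar>"
    unfolding V_max_def by (rule Greatest_equality) (use M M' in auto)
  with M' show "\<bar>V t\<bar> \<le> V_max V" by simp
qed

section \<open>The critical constant and the singular term\<close>

lemma A_bound_attained:
  assumes "\<alpha> > 0"
  obtains a where "0 < a" "a < 1" "A_bound \<alpha> = a * (1 - \<alpha> * a) * (1 - a)\<^sup>2"
proof
  \<comment> \<open>The smaller root of
    \<open>4 * \<alpha> * x^2 - (2 * \<alpha> + 3) * x + 1\<close>, the factor left after dividing
    the derivative of \<open>x * (1 - \<alpha> * x) * (1 - x)^2\<close> by
    \<open>1 - x\<close>.\<close>
  let ?a = "(2 * \<alpha> + 3 - mu \<alpha>) / (8 * \<alpha>)"
  have "mu \<alpha> < 2 * \<alpha> + 3"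
    unfolding mu_def using assms by (intro real_less_lsqrt) (auto simp: power2_eq_square algebra_simps)
  then show "0 < ?a" using assms by simp
  \<comment> \<open>Equivalent to \<open>?a < 1\<close>. If the left side is nonnegative, then
    \<open>\<alpha> \<le> 1/2\<close> and the squares differ by
    \<open>32 * \<alpha> * (1 - \<alpha>) > 0\<close>.\<close>
  have "3 - 6 * \<alpha> < mu \<alpha>"
  proof (cases "3 - 6 * \<alpha> \<ge> 0")
    case True
    then have "\<alpha> * \<alpha> * 32 < 32 * \<alpha>" using assms by (simp add: field_simps)
    then show ?thesis
      unfolding mu_def by (intro real_less_rsqrt) (simp add: power2_eq_square algebra_simps)
  next
    case False
    have "4 * \<alpha>\<^sup>2 - 4 * \<alpha> + 9 = (2 * \<alpha> - 1)\<^sup>2 + 8" by (simp add: power2_eq_square algebra_simps)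
    then have "mu \<alpha> \<ge> 0"
      unfolding mu_def by (simp only:) (intro real_sqrt_ge_zero add_nonneg_nonneg; simp)
    with False show ?thesis by simp
  qed
  then show "?a < 1" using assms by (simp add: field_simps)
  have "1 - \<alpha> * ?a = (5 - 2 * \<alpha> + mu \<alpha>) / 8"
    using assms by (simp add: field_simps)
  moreover have "1 - ?a = (6 * \<alpha> - 3 + mu \<alpha>) / (8 * \<alpha>)"
    using assms by (simp add: field_simps)
  ultimately show "A_bound \<alpha> = ?a * (1 - \<alpha> * ?a) * (1 - ?a)\<^sup>2"
    using assms unfolding A_bound_def
    by (simp only:) (simp add: power_divide power_mult_distrib power3_eq_cube power2_eq_square)
qed

text \<open>With \<open>p = 1 - y\<close> and \<open>q = 1 - x\<close>, the difference factors
  through \<open>q - p\<close>; the cofactor is a sum of two reciprocals of cubic products, each at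
  most \<open>1 / d ^ 3\<close>.\<close>

lemma inverse_square_lipschitz:
  fixes x y d :: real
  assumes "x \<le> y" "0 < d" "d \<le> 1 - y"
  shows "1 / (1 - y)\<^sup>2 - 1 / (1 - x)\<^sup>2 \<le> 2 / d ^ 3 * (y - x)"
proof -
  define p q where "p = 1 - y" and "q = 1 - x"
  have pq: "0 < p" "p \<le> q" "d \<le> p" using assms by (auto simp: p_def q_def)
  have "1 / p\<^sup>2 - 1 / q\<^sup>2 = (q - p) * (1 / (p\<^sup>2 * q) + 1 / (p * q\<^sup>2))"
    using pq by (simp add: divide_simps) (simp add: power2_eq_square algebra_simps)
  also have "\<dots> \<le> (q - p) * (1 / d ^ 3 + 1 / d ^ 3)"
  proof (intro mult_left_mono add_mono divide_left_mono)
    have "d * d * d \<le> p * p * q" "d * d * d \<le> p * (q * q)"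
      using pq assms(2) by (auto simp: mult.assoc intro!: mult_mono)
    then show "d ^ 3 \<le> p\<^sup>2 * q" "d ^ 3 \<le> p * q\<^sup>2"
      by (simp_all add: power2_eq_square power3_eq_cube)
  qed (use pq assms(2) in auto)
  also have "q - p = y - x" by (simp add: p_def q_def)
  finally show ?thesis by (simp add: p_def q_def mult.commute)
qed

section \<open>Application to the singular equation\<close>

theorem theorem3p1:
  fixes c \<alpha> T :: real and V :: "real \<Rightarrow> real"
  assumes "c \<ge> 0" and "\<alpha> > 0" and "T > 0"
    and "continuous_on UNIV V" and "has_period V T"
    and "V_min V > 0"
    and "(V_max V)^2 \<le> A_bound \<alpha>"
  shows "\<exists>x. is_solution c \<alpha> V x \<and> has_period x T"
proof -
  note V_bounds = V_min_le_abs_le_V_max[OF assms(3-5)]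
  obtain a where a: "0 < a" "a < 1" "A_bound \<alpha> = a * (1 - \<alpha> * a) * (1 - a)\<^sup>2"
    using A_bound_attained[OF \<open>\<alpha> > 0\<close>] .
  \<comment> \<open>The upper solution is \<open>1 - d\<close>. The bound by \<open>V_min V\<close>
    gives \<open>(V t)^2 / d^2 \<ge> 1\<close>, enough to outweigh \<open>- x\<close> there; the
    bound by \<open>1 - a\<close> keeps \<open>a \<le> 1 - d\<close>.\<close>
  define d where "d = min (V_min V) (1 - a)"
  have d: "0 < d" "d \<le> V_min V" "a \<le> 1 - d" using assms(6) a by (auto simp: d_def)
  define f where "f t x = (V t)\<^sup>2 / (1 - x)\<^sup>2 - x + \<alpha> * \<bar>x\<bar> * x" for t x
  \<comment> \<open>The first summand bounds the growth of the singular term, and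
    \<open>2 * \<alpha>\<close> that of the quadratic term, since \<open>x + y \<le> 2\<close>. The
    term \<open>- x\<close> is decreasing and only helps.\<close>
  define K where "K = (V_max V)\<^sup>2 * (2 / d ^ 3) + 2 * \<alpha>"
  have "K > 0" using d \<open>\<alpha> > 0\<close> by (auto simp: K_def intro!: add_nonneg_pos)
  have V2: "(V t)\<^sup>2 \<le> (V_max V)\<^sup>2" for t
    using V_bounds(2)[of t] by (metis abs_ge_zero power2_abs power_mono)
  have cont: "continuous_on (UNIV \<times> {a..1 - d}) (\<lambda>(t, x). f t x)"
    unfolding f_def split_beta using d
    by (auto intro!: continuous_intros continuous_on_compose2[OF assms(4)])
  have growth: "f t y - f t x \<le> K * (y - x)" if "a \<le> x" "x \<le> y" "y \<le> 1 - d" for t x y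
  proof -
    have "(V t)\<^sup>2 * (1 / (1 - y)\<^sup>2 - 1 / (1 - x)\<^sup>2) \<le> (V t)\<^sup>2 * (2 / d ^ 3 * (y - x))"
      by (intro mult_left_mono inverse_square_lipschitz) (use that d in auto)
    also have "\<dots> \<le> (V_max V)\<^sup>2 * (2 / d ^ 3 * (y - x))"
      by (intro mult_right_mono V2) (use that d in auto)
    finally have "(V t)\<^sup>2 * (1 / (1 - y)\<^sup>2 - 1 / (1 - x)\<^sup>2) \<le> (V_max V)\<^sup>2 * (2 / d ^ 3) * (y - x)"
      by (simp only: mult.assoc)
    moreover have "\<alpha> * \<bar>y\<bar> * y - \<alpha> * \<bar>x\<bar> * x = \<alpha> * (y + x) * (y - x)"
      using that a by (simp add: algebra_simps)
    moreover have "\<alpha> * (y + x) * (y - x) \<le> \<alpha> * 2 * (y - x)"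
      using that a d \<open>\<alpha> > 0\<close> by (intro mult_right_mono mult_left_mono) auto
    ultimately show ?thesis
      using that unfolding f_def K_def by (simp add: algebra_simps)
  qed
  have lower: "f t a \<le> 0" for t
  proof -
    \<comment> \<open>The hypothesis on \<open>V_max V\<close>, divided by
      \<open>(1 - a)^2\<close>.\<close>
    have "(V t)\<^sup>2 / (1 - a)\<^sup>2 \<le> a * (1 - \<alpha> * a)"
      using order_trans[OF V2[of t] assms(7)] a by (simp add: pos_divide_le_eq)
    then show ?thesis using a by (simp add: f_def algebra_simps)
  qed
  have upper: "f t (1 - d) \<ge> 0" for t
  proof -
    have "d\<^sup>2 \<le> \<bar>V t\<bar>\<^sup>2"
      using V_bounds(1)[of t] d by (intro power_mono) auto
    then have "1 \<le> (V t)\<^sup>2 / d\<^sup>2" using d by (simp add: le_divide_eq)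
    moreover have "0 \<le> \<alpha> * \<bar>1 - d\<bar> * (1 - d)" using d a \<open>\<alpha> > 0\<close> by simp
    ultimately have "0 \<le> (V t)\<^sup>2 / d\<^sup>2 - (1 - d) + \<alpha> * \<bar>1 - d\<bar> * (1 - d)"
      using d by linarith
    then show ?thesis by (simp add: f_def)
  qed
  have per: "f (t + T) x = f t x" for t x
    using assms(5) by (simp add: f_def has_period_def)
  show ?thesis
  proof (rule periodic_solution_between_constants[where c = c,
        OF \<open>T > 0\<close> d(3) \<open>K > 0\<close> cont per _ lower upper])
    fix u u' u''
    assume u: "has_period u T" "\<And>t. u t \<in> {a..1 - d}"
      "\<And>t. (u has_real_derivative u' t) (at t)"
      "\<And>t. (u' has_real_derivative u'' t) (at t)"
      "\<And>t. u'' t + c * u' t = f t (u t)"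
    have "u t < 1" for t using u(2)[of t] d by auto
    moreover have "u'' t + c * u' t + u t - \<alpha> * \<bar>u t\<bar> * u t = (V t)\<^sup>2 / (1 - u t)\<^sup>2" for t
      using u(5)[of t] by (simp add: f_def)
    ultimately have "is_solution c \<alpha> V u"
      unfolding is_solution_def using u(3,4) by blast
    with u(1) show ?thesis by blast
  qed (rule growth)
qed

end
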